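(* Let $(\mathcal X^n)_{n\ge 1}$ be a large market as described in the context, with numéraire portfolios $V^n\in\mathcal X^n_1$ and sets $\mathcal D^n$ of equivalent supermartingale densities. The following conditions are equivalent: (a) NAA (there is no asymptotic arbitrage on $(\mathcal X^n)$); (b) $(Y^n_T|\mathsf P^n)$ is tight for any sequence $Y^n\in\mathcal X^n_1$; (c) $(V^n_T|\mathsf P^n)$ is tight; (d) $(\mathsf P^n)\lhd ((V_T^n)^{-1}\cdot\mathsf P^n)$; (e) $(\mathsf P^n)\lhd (Z_T^n\cdot\mathsf P^n)$ for some sequence $Z^n\in\mathcal D^n$.
   Context: Setting. For each $n\ge1$, $(\Omega^n,\mathcal F^n_T,\mathsf P^n)$ is a probability space with a filtration $\mathbb F^n=(\mathcal F^n_t)_{t\in\mathbb T^n}$, where $\mathbb T^n$ is an interval $[0,T(n)]$ or a set of integers $\{0,\dots,T(n)\}$; the $\sigma$-algebra $\mathcal F^n_0$ is trivial up to $\mathsf P^n$-null sets. A subscript $T$ on an object of the $n$-th market means $T(n)$ (so $\mathcal F^n_T=\mathcal F^n_{T(n)}$, $X^n_T=X^n_{T(n)}$). $\mathcal X^n$ is a family of non-negative $\mathbb F^n$-adapted processes such that: (i) $1\in\mathcal X^n$, and $X\in\mathcal X^n$, $\lambda>0$ imply $\lambda X\in\mathcal X^n$; (ii) there is a strictly positive process (numéraire portfolio) $V^n\in\mathcal X^n_1=\{X^n\in\mathcal X^n: X^n_0=1\}$ such that $X^n/V^n$ is a $\mathsf P^n$-supermartingale for all $X^n\in\mathcal X^n$.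 The large market is the sequence $(\mathcal X^n)_{n\ge1}$. NAA (no asymptotic arbitrage): for any sequence $X^n\in\mathcal X^n$, $X^n_0\to0$ implies $\limsup_{n\to\infty}\mathsf P^n(X^n_T\ge1)=0$. $\mathcal D^n$ is the set of equivalent supermartingale densities: strictly positive $\mathbb F^n$-adapted processes $Z^n$ with $Z^n_0=1$ such that $X^nZ^n$ is a $\mathsf P^n$-supermartingale for all $X^n\in\mathcal X^n$. For a non-negative $\mathcal F^n_T$-measurable random variable $\xi^n$, $\xi^n\cdot\mathsf P^n$ is the measure $A\mapsto\mathsf E_{\mathsf P^n}(\xi^nI_A)$, $A\in\mathcal F^n_T$. The measures $Z^n_T\cdot\mathsf P^n$, $Z^n\in\mathcal D^n$, are sub-probability measures (countably additive with values in $[0,1]$). For probability measures $\mathsf P^n$ and sub-probability measures $\mathsf Q^n$ on $\mathcal F^n_T$: $(\mathsf P^n)\lhd(\mathsf Q^n)$ (contiguity) means that $\mathsf Q^n(A^n)\to0$, $A^n\in\mathcal F^n_T$, implies $\mathsf P^n(A^n)\to0$. For non-negative $\mathcal F^n_T$-measurable random variables $\xi^n$, $(\xi^n|\mathsf P^n)$ is tight if $\lim_{M\to\infty}\limsup_{n\to\infty}\mathsf P^n(\xi^n\ge M)=0$. *)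

theory Defs
  imports "HOL-Probability.Probability"
begin

definition time_domain :: "real \<Rightarrow> real set \<Rightarrow> bool" where
  "time_domain T I \<longleftrightarrow>
     0 \<le> T \<and> (I = {0..T} \<or> (\<exists>N::nat. T = real N \<and> I = real ` {0..N}))"

(* Only the space and the sigma-algebra of each F t matter, not its measure. *)
locale stochastic_basis = prob_space P
  for P :: "'a measure" +
  fixes T :: real and I :: "real set" and F :: "real \<Rightarrow> 'a measure"
  assumes time_domain: "time_domain T I"
    and subalg: "\<And>t. t \<in> I \<Longrightarrow> subalgebra P (F t)"
    and mono: "\<And>s t. s \<in> I \<Longrightarrow> t \<in> I \<Longrightarrow> s \<le> t \<Longrightarrow> subalgebra (F t) (F s)"
    and terminal: "sets (F T) = sets P"
    and initial_trivial: "\<And>A. A \<in> sets (F 0) \<Longrightarrow> measure P A = 0 \<or> measure P A = 1"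

(* A process is a total function on real; its values outside the time domain I
   and outside the sample space are irrelevant. *)
type_synonym 'a process = "real \<Rightarrow> 'a \<Rightarrow> real"

definition adapted :: "real set \<Rightarrow> (real \<Rightarrow> 'a measure) \<Rightarrow> 'a process \<Rightarrow> bool" where
  "adapted I F X \<longleftrightarrow> (\<forall>t\<in>I. X t \<in> borel_measurable (F t))"

definition nonneg_process :: "'a measure \<Rightarrow> real set \<Rightarrow> 'a process \<Rightarrow> bool" where
  "nonneg_process P I X \<longleftrightarrow> (\<forall>t\<in>I. \<forall>\<omega>\<in>space P. 0 \<le> X t \<omega>)"

definition pos_process :: "'a measure \<Rightarrow> real set \<Rightarrow> 'a process \<Rightarrow> bool" where
  "pos_process P I X \<longleftrightarrow> (\<forall>t\<in>I. \<forall>\<omega>\<in>space P. 0 < X t \<omega>)"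

definition supermartingale ::
  "'a measure \<Rightarrow> real set \<Rightarrow> (real \<Rightarrow> 'a measure) \<Rightarrow> 'a process \<Rightarrow> bool" where
  "supermartingale P I F X \<longleftrightarrow>
     adapted I F X \<and> (\<forall>t\<in>I. integrable P (X t)) \<and>
     (\<forall>s\<in>I. \<forall>t\<in>I. s \<le> t \<longrightarrow> (AE \<omega> in P. real_cond_exp P (F s) (X t) \<omega> \<le> X s \<omega>))"

(* The initial sigma-algebra is trivial only up to null sets, so the initial value
   of an adapted process is a deterministic number only almost surely. *)
definition starts_at :: "'a measure \<Rightarrow> 'a process \<Rightarrow> real \<Rightarrow> bool" where
  "starts_at P X x \<longleftrightarrow> (AE \<omega> in P. X 0 \<omega> = x)"

definition unit_start :: "'a measure \<Rightarrow> 'a process set \<Rightarrow> 'a process set" where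
  "unit_start P \<X> = {X \<in> \<X>. starts_at P X 1}"

definition numeraire_portfolio ::
  "'a measure \<Rightarrow> real set \<Rightarrow> (real \<Rightarrow> 'a measure) \<Rightarrow> 'a process set \<Rightarrow> 'a process \<Rightarrow> bool" where
  "numeraire_portfolio P I F \<X> V \<longleftrightarrow>
     V \<in> unit_start P \<X> \<and> pos_process P I V \<and>
     (\<forall>X\<in>\<X>. supermartingale P I F (\<lambda>t \<omega>. X t \<omega> / V t \<omega>))"

locale market = stochastic_basis P T I F
  for P :: "'a measure" and T :: real and I :: "real set" and F :: "real \<Rightarrow> 'a measure" +
  fixes \<X> :: "'a process set"
  assumes wealth_adapted: "\<And>X. X \<in> \<X> \<Longrightarrow> adapted I F X"
    and wealth_nonneg: "\<And>X. X \<in> \<X> \<Longrightarrow> nonneg_process P I X"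
    and one_mem: "(\<lambda>t \<omega>. 1) \<in> \<X>"
    and scale_mem: "\<And>X c. X \<in> \<X> \<Longrightarrow> 0 < c \<Longrightarrow> (\<lambda>t \<omega>. c * X t \<omega>) \<in> \<X>"
    and numeraire_exists: "\<exists>V. numeraire_portfolio P I F \<X> V"

definition supermartingale_densities ::
  "'a measure \<Rightarrow> real set \<Rightarrow> (real \<Rightarrow> 'a measure) \<Rightarrow> 'a process set \<Rightarrow> 'a process set" where
  "supermartingale_densities P I F \<X> =
     {Z. adapted I F Z \<and> pos_process P I Z \<and> starts_at P Z 1 \<and>
         (\<forall>X\<in>\<X>. supermartingale P I F (\<lambda>t \<omega>. X t \<omega> * Z t \<omega>))}"

(* In the following, sequences are indexed by n \<ge> 1; the entry at 0 is irrelevant.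
   The sample spaces space (P n) may differ from one n to another. *)

definition NAA ::
  "(nat \<Rightarrow> 'a measure) \<Rightarrow> (nat \<Rightarrow> real) \<Rightarrow> (nat \<Rightarrow> 'a process set) \<Rightarrow> bool" where
  "NAA P T \<X> \<longleftrightarrow>
     (\<forall>X x. (\<forall>n\<ge>1. X n \<in> \<X> n \<and> starts_at (P n) (X n) (x n)) \<longrightarrow> x \<longlonglongrightarrow> 0 \<longrightarrow>
        limsup (\<lambda>n. ereal (measure (P n) {\<omega> \<in> space (P n). 1 \<le> X n (T n) \<omega>})) = 0)"

definition tight_variables :: "(nat \<Rightarrow> 'a measure) \<Rightarrow> (nat \<Rightarrow> 'a \<Rightarrow> real) \<Rightarrow> bool" where
  "tight_variables P \<xi> \<longleftrightarrow>
     ((\<lambda>K::real. limsup (\<lambda>n. ereal (measure (P n) {\<omega> \<in> space (P n). K \<le> \<xi> n \<omega>})))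
        \<longlongrightarrow> 0) at_top"

definition contiguous :: "(nat \<Rightarrow> 'a measure) \<Rightarrow> (nat \<Rightarrow> 'a measure) \<Rightarrow> bool" where
  "contiguous P Q \<longleftrightarrow>
     (\<forall>A. (\<forall>n\<ge>1. A n \<in> sets (P n)) \<longrightarrow>
        (\<lambda>n. emeasure (Q n) (A n)) \<longlonglongrightarrow> 0 \<longrightarrow> (\<lambda>n. emeasure (P n) (A n)) \<longlonglongrightarrow> 0)"

end

theory Submission
  imports Defs
begin

text \<open>
  The five conditions are linked in one cycle, NAA to tightness of all wealth processes of
  unit initial value, to tightness of \<open>V\<close>, to contiguity for \<open>1/V\<close>, to contiguity for some
  density \<open>Z\<close>, and back to NAA. Three ideas carry it.

  First, arbitrage and lack of tightness are the same thing up to scaling: dividing \<open>Y n\<close>, which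
  starts at 1, by constants \<open>K n\<close> that tend to infinity gives wealth processes whose initial
  values vanish, and \<open>Y n / K n\<close> reaches level 1 exactly when \<open>Y n\<close> reaches \<open>K n\<close>. Under NAA
  the probability that \<open>Y n\<close> reaches \<open>K n\<close> therefore vanishes for all such \<open>K\<close>: this is tightness
  (\<open>tight_variables_if_escaping_levels\<close>).

  Second, on the event \<open>V < K\<close> the measure with density \<open>1/V\<close> dominates \<open>1/K\<close> times \<open>P\<close>; so a
  sequence of events that is negligible for this measure can be charged by \<open>P\<close> only where \<open>V\<close> is
  large (\<open>prob_le_tail_plus_inverse_density\<close>), and tightness of \<open>V\<close> gives contiguity. The process
  \<open>1/V\<close> is itself a supermartingale density, by the very definition of a numeraire portfolio.

  Third, for any supermartingale density \<open>Z\<close>, Markov's inequality under the measure with density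
  \<open>Z\<close> bounds the mass of the event \<open>X \<ge> 1\<close> by the initial value of \<open>X\<close>
  (\<open>density_measure_reaching_one\<close>), so vanishing initial values give events that are negligible
  for this measure, and by contiguity for \<open>P\<close>.
\<close>

section \<open>Tightness\<close>

lemma limsup_nonneg_eq_0_iff:
  fixes p :: "nat \<Rightarrow> real"
  assumes "\<And>n. 0 \<le> p n"
  shows "limsup (\<lambda>n. ereal (p n)) = 0 \<longleftrightarrow> p \<longlonglongrightarrow> 0"
proof
  assume L: "limsup (\<lambda>n. ereal (p n)) = 0"
  have "0 \<le> liminf (\<lambda>n. ereal (p n))"
    by (rule Liminf_bounded) (simp add: assms)
  then have "liminf (\<lambda>n. ereal (p n)) = 0"
    using L Liminf_le_Limsup[of sequentially "\<lambda>n. ereal (p n)"] by auto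
  then have "(\<lambda>n. ereal (p n)) \<longlonglongrightarrow> ereal 0"
    using L by (intro Liminf_eq_Limsup) (auto simp: zero_ereal_def)
  then show "p \<longlonglongrightarrow> 0"
    by simp
next
  assume "p \<longlonglongrightarrow> 0"
  then have "(\<lambda>n. ereal (p n)) \<longlonglongrightarrow> ereal 0"
    by simp
  then show "limsup (\<lambda>n. ereal (p n)) = 0"
    by (metis lim_imp_Limsup sequentially_bot zero_ereal_def)
qed

lemma tight_variablesD:
  assumes "tight_variables P \<xi>" "0 < (\<epsilon>::real)"
  obtains K where "0 < K"
    "\<forall>\<^sub>F n in sequentially. measure (P n) {\<omega> \<in> space (P n). K \<le> \<xi> n \<omega>} < \<epsilon>"
proof -
  have "\<forall>\<^sub>F K in at_top.
      limsup (\<lambda>n. ereal (measure (P n) {\<omega> \<in> space (P n). K \<le> \<xi> n \<omega>})) < ereal \<epsilon>"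
    using assms order_tendstoD(2)[of _ "0::ereal" at_top "ereal \<epsilon>"]
    unfolding tight_variables_def by simp
  then have "\<forall>\<^sub>F K in at_top. 0 < K \<and>
      limsup (\<lambda>n. ereal (measure (P n) {\<omega> \<in> space (P n). K \<le> \<xi> n \<omega>})) < ereal \<epsilon>"
    by (intro eventually_conj eventually_gt_at_top)
  then obtain K where K: "0 < K"
      "limsup (\<lambda>n. ereal (measure (P n) {\<omega> \<in> space (P n). K \<le> \<xi> n \<omega>})) < ereal \<epsilon>"
    by (metis (no_types, lifting) eventually_happens trivial_limit_at_top_linorder)
  from Limsup_lessD[OF K(2)] K(1) show ?thesis
    by (intro that) auto
qed

text \<open>
  If tightness fails, infinitely many indices put mass at least some \<open>\<epsilon>\<close> beyond each level. A
  diagonal choice of indices \<open>r k\<close>, with level \<open>k + 1\<close> at index \<open>r k\<close>, then yields one escaping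
  sequence of levels along which the tail mass does not vanish. The levels are required to be
  positive because they serve as divisors of wealth processes.
\<close>
lemma tight_variables_if_escaping_levels:
  assumes prob: "\<And>n. n \<ge> 1 \<Longrightarrow> prob_space (P n)"
    and meas: "\<And>n. n \<ge> 1 \<Longrightarrow> \<xi> n \<in> borel_measurable (P n)"
    and escape: "\<And>K. (\<And>n. 0 < K n) \<Longrightarrow> filterlim K at_top sequentially \<Longrightarrow>
      (\<lambda>n. measure (P n) {\<omega> \<in> space (P n). K n \<le> \<xi> n \<omega>}) \<longlonglongrightarrow> 0"
  shows "tight_variables P \<xi>"
proof -
  define p where "p n K = measure (P n) {\<omega> \<in> space (P n). K \<le> \<xi> n \<omega>}" for n and K :: real
  have p_nonneg: "0 \<le> p n K" for n K
    by (simp add: p_def)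
  have p_antimono: "p n L \<le> p n K" if "n \<ge> 1" "K \<le> L" for n K L
  proof -
    interpret prob_space "P n" using prob that by simp
    have [measurable]: "\<xi> n \<in> borel_measurable (P n)" using meas that by simp
    show ?thesis
      unfolding p_def using that by (intro finite_measure_mono) auto
  qed
  have eps: "\<exists>k::nat. \<forall>\<^sub>F n in sequentially. p n (real k) < \<epsilon>" if "0 < \<epsilon>" for \<epsilon>
  proof (rule ccontr)
    assume "\<not> ?thesis"
    then have "\<exists>\<^sub>F n in sequentially. \<epsilon> \<le> p n (real k)" for k :: nat
      by (simp add: not_eventually not_less)
    then have often: "\<exists>n>m. \<epsilon> \<le> p n (real k)" for k m
      unfolding frequently_sequentially by (meson Suc_le_eq)
    have "\<exists>r. \<forall>k::nat. \<epsilon> \<le> p (r k) (real (Suc k)) \<and> r k < r (Suc k)"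
      by (rule dependent_nat_choice[where P = "\<lambda>k n. \<epsilon> \<le> p n (real (Suc k))"
            and Q = "\<lambda>_ m n. m < n"]) (use often in blast)+
    then obtain r where r: "\<And>k::nat. \<epsilon> \<le> p (r k) (real (Suc k))" and "strict_mono r"
      by (auto simp: strict_mono_Suc_iff)
    then have inj: "inj r"
      by (simp add: strict_mono_imp_inj_on)
    \<comment> \<open>Away from the chosen indices, \<open>n + 1\<close> serves only to make the levels tend to infinity.\<close>
    define K where "K n = real (Suc (if n \<in> range r then inv r n else n))" for n
    have "filterlim K at_top sequentially"
      unfolding filterlim_at_top
    proof
      fix Z :: real
      have "{n. \<not> Z \<le> K n} \<subseteq> r ` {..nat \<lceil>Z\<rceil>} \<union> {..nat \<lceil>Z\<rceil>}"
      proof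
        fix n assume "n \<in> {n. \<not> Z \<le> K n}"
        then have "real (if n \<in> range r then inv r n else n) < Z"
          unfolding K_def mem_Collect_eq of_nat_Suc by linarith
        then have "(if n \<in> range r then inv r n else n) \<le> nat \<lceil>Z\<rceil>"
          by linarith
        then show "n \<in> r ` {..nat \<lceil>Z\<rceil>} \<union> {..nat \<lceil>Z\<rceil>}"
          by (auto split: if_splits simp: inj)
      qed
      then show "\<forall>\<^sub>F n in sequentially. Z \<le> K n"
        unfolding cofinite_eq_sequentially[symmetric] eventually_cofinite
        by (rule finite_subset) simp
    qed
    moreover have "0 < K n" for n
      by (simp add: K_def)
    ultimately have "(\<lambda>n. p n (K n)) \<longlonglongrightarrow> 0"
      unfolding p_def by (intro escape)
    then have "(\<lambda>k. p (r k) (K (r k))) \<longlonglongrightarrow> 0"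
      using LIMSEQ_subseq_LIMSEQ[OF _ \<open>strict_mono r\<close>] by (auto simp: o_def)
    then have "\<epsilon> \<le> 0"
      using r by (intro LIMSEQ_le_const) (auto simp: K_def inj)
    with that show False by simp
  qed
  have "((\<lambda>K. limsup (\<lambda>n. ereal (p n K))) \<longlongrightarrow> 0) at_top"
  proof (rule order_tendstoI)
    fix a :: ereal assume "a < 0"
    moreover have "0 \<le> limsup (\<lambda>n. ereal (p n K))" for K
      by (intro le_Limsup) (auto simp: p_nonneg)
    ultimately show "\<forall>\<^sub>F K in at_top. a < limsup (\<lambda>n. ereal (p n K))"
      by (simp add: less_le_trans)
  next
    fix a :: ereal assume "0 < a"
    then obtain \<epsilon> :: real where e: "0 < \<epsilon>" "ereal \<epsilon> < a"
      using ereal_dense2[of 0 a] by auto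
    obtain k :: nat where k: "\<forall>\<^sub>F n in sequentially. p n (real k) < \<epsilon>"
      using eps[OF e(1)] by blast
    have "limsup (\<lambda>n. ereal (p n K)) < a" if "real k \<le> K" for K
    proof -
      have "\<forall>\<^sub>F n in sequentially. ereal (p n K) \<le> ereal \<epsilon>"
        using k eventually_ge_at_top[of 1]
        by eventually_elim (use p_antimono that in fastforce)
      from Limsup_bounded[OF this] e(2) show ?thesis
        by (rule le_less_trans)
    qed
    then show "\<forall>\<^sub>F K in at_top. limsup (\<lambda>n. ereal (p n K)) < a"
      unfolding eventually_at_top_linorder by blast
  qed
  then show ?thesis
    unfolding tight_variables_def p_def .
qed

section \<open>A single market\<close>

context stochastic_basis
begin

lemma zero_in_time: "0 \<in> I" and horizon_in_time: "T \<in> I" and horizon_nonneg: "0 \<le> T"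
  using time_domain unfolding time_domain_def by (auto simp: image_iff)

lemma adapted_measurable:
  assumes "adapted I F X" "t \<in> I"
  shows "X t \<in> borel_measurable P"
  using assms subalg[OF assms(2)] measurable_from_subalg unfolding adapted_def by blast

lemma supermartingale_expectation_le:
  assumes "supermartingale P I F X"
  shows "(\<integral>\<omega>. X T \<omega> \<partial>P) \<le> (\<integral>\<omega>. X 0 \<omega> \<partial>P)"
proof -
  interpret finite_measure_subalgebra P "F 0"
    by unfold_locales (rule subalg[OF zero_in_time])
  have int: "integrable P (X T)" "integrable P (X 0)"
    and ae: "AE \<omega> in P. real_cond_exp P (F 0) (X T) \<omega> \<le> X 0 \<omega>"
    using assms zero_in_time horizon_in_time horizon_nonneg unfolding supermartingale_def by auto
  have "(\<integral>\<omega>. X T \<omega> \<partial>P) = (\<integral>\<omega>. real_cond_exp P (F 0) (X T) \<omega> \<partial>P)"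
    using real_cond_exp_int(2)[OF int(1)] by simp
  also have "\<dots> \<le> (\<integral>\<omega>. X 0 \<omega> \<partial>P)"
    using real_cond_exp_int(1)[OF int(1)] int(2) ae by (rule integral_mono_AE)
  finally show ?thesis .
qed

text \<open>
  On the event \<open>v < K\<close> the density \<open>1/v\<close> exceeds \<open>1/K\<close>, so there \<open>P\<close> is at most \<open>K\<close> times the
  measure with density \<open>1/v\<close>.
\<close>
lemma prob_le_tail_plus_inverse_density:
  assumes [measurable]: "v \<in> borel_measurable P" "A \<in> sets P"
    and pos: "\<And>\<omega>. \<omega> \<in> space P \<Longrightarrow> 0 < v \<omega>" and K: "0 < K"
  shows "emeasure P A \<le> ennreal (measure P {\<omega> \<in> space P. K \<le> v \<omega>})
    + ennreal K * emeasure (density P (\<lambda>\<omega>. ennreal (inverse (v \<omega>)))) A"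
proof -
  have "emeasure P A = (\<integral>\<^sup>+\<omega>. indicator A \<omega> \<partial>P)"
    by simp
  also have "\<dots> \<le> (\<integral>\<^sup>+\<omega>. indicator {\<omega> \<in> space P. K \<le> v \<omega>} \<omega>
      + ennreal K * (ennreal (inverse (v \<omega>)) * indicator A \<omega>) \<partial>P)"
  proof (rule nn_integral_mono)
    fix \<omega> assume w: "\<omega> \<in> space P"
    have "1 \<le> K * inverse (v \<omega>)" if "\<not> K \<le> v \<omega>"
      using that pos[OF w] by (simp add: field_simps)
    then have "1 \<le> ennreal K * ennreal (inverse (v \<omega>))" if "\<not> K \<le> v \<omega>"
      using that K by (simp add: ennreal_mult'[symmetric])
    then show "(indicator A \<omega> :: ennreal) \<le> indicator {\<omega> \<in> space P. K \<le> v \<omega>} \<omega>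
        + ennreal K * (ennreal (inverse (v \<omega>)) * indicator A \<omega>)"
      using w by (cases "K \<le> v \<omega>") (auto simp: indicator_def)
  qed
  also have "\<dots> = emeasure P {\<omega> \<in> space P. K \<le> v \<omega>}
      + ennreal K * (\<integral>\<^sup>+\<omega>. ennreal (inverse (v \<omega>)) * indicator A \<omega> \<partial>P)"
    by (subst nn_integral_add) (auto simp: nn_integral_cmult)
  finally show ?thesis
    by (simp add: emeasure_density emeasure_eq_measure)
qed

end

context market
begin

lemma wealth_measurable: "X \<in> \<X> \<Longrightarrow> X T \<in> borel_measurable P"
  using adapted_measurable wealth_adapted horizon_in_time by blast

lemma inverse_numeraire_is_density:
  assumes "numeraire_portfolio P I F \<X> V"
  shows "(\<lambda>t \<omega>. inverse (V t \<omega>)) \<in> supermartingale_densities P I F \<X>"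
proof -
  have V: "V \<in> \<X>" "starts_at P V 1" "pos_process P I V"
    "\<And>X. X \<in> \<X> \<Longrightarrow> supermartingale P I F (\<lambda>t \<omega>. X t \<omega> / V t \<omega>)"
    using assms unfolding numeraire_portfolio_def unit_start_def by auto
  have "starts_at P (\<lambda>t \<omega>. inverse (V t \<omega>)) 1"
    using V(2) unfolding starts_at_def by eventually_elim simp
  then show ?thesis
    using V wealth_adapted[OF V(1)]
    unfolding supermartingale_densities_def adapted_def pos_process_def
    by (auto simp: divide_inverse)
qed

text \<open>
  Markov's inequality for \<open>X\<close> under the measure with density \<open>Z\<close>, whose expectation of the
  terminal wealth is at most \<open>x\<close> because \<open>X Z\<close> is a supermartingale started at \<open>x\<close>.
\<close>
lemma density_measure_reaching_one:
  assumes Z: "Z \<in> supermartingale_densities P I F \<X>" and X: "X \<in> \<X>" "starts_at P X x"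
  shows "emeasure (density P (\<lambda>\<omega>. ennreal (Z T \<omega>))) {\<omega> \<in> space P. 1 \<le> X T \<omega>} \<le> ennreal x"
proof -
  have Z: "adapted I F Z" "pos_process P I Z" "starts_at P Z 1"
    "supermartingale P I F (\<lambda>t \<omega>. X t \<omega> * Z t \<omega>)"
    using Z X(1) unfolding supermartingale_densities_def by auto
  have [measurable]: "X T \<in> borel_measurable P" "Z T \<in> borel_measurable P"
    using wealth_measurable[OF X(1)] adapted_measurable[OF Z(1) horizon_in_time] by auto
  have nonneg: "0 \<le> X T \<omega>" "0 \<le> Z T \<omega>" if "\<omega> \<in> space P" for \<omega>
    using wealth_nonneg[OF X(1)] Z(2) horizon_in_time that
    unfolding nonneg_process_def pos_process_def by (auto intro: less_imp_le)
  have int: "integrable P (\<lambda>\<omega>. X T \<omega> * Z T \<omega>)"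
    using Z(4) horizon_in_time unfolding supermartingale_def by auto
  have ae0: "AE \<omega> in P. X 0 \<omega> * Z 0 \<omega> = x"
    using X(2) Z(3) unfolding starts_at_def by eventually_elim simp
  have "X 0 \<in> borel_measurable P" "Z 0 \<in> borel_measurable P"
    using adapted_measurable zero_in_time wealth_adapted[OF X(1)] Z(1) by auto
  then have "(\<integral>\<omega>. X 0 \<omega> * Z 0 \<omega> \<partial>P) = (\<integral>\<omega>. x \<partial>P)"
    using ae0 by (intro integral_cong_AE) auto
  then have exp: "(\<integral>\<omega>. X T \<omega> * Z T \<omega> \<partial>P) \<le> x"
    using supermartingale_expectation_le[OF Z(4)] by (simp add: prob_space)
  have "emeasure (density P (\<lambda>\<omega>. ennreal (Z T \<omega>))) {\<omega> \<in> space P. 1 \<le> X T \<omega>}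
      = (\<integral>\<^sup>+\<omega>. ennreal (Z T \<omega>) * indicator {\<omega> \<in> space P. 1 \<le> X T \<omega>} \<omega> \<partial>P)"
    by (intro emeasure_density) auto
  also have "\<dots> \<le> (\<integral>\<^sup>+\<omega>. ennreal (X T \<omega> * Z T \<omega>) \<partial>P)"
  proof (rule nn_integral_mono)
    fix \<omega> assume "\<omega> \<in> space P"
    then show "ennreal (Z T \<omega>) * indicator {\<omega> \<in> space P. 1 \<le> X T \<omega>} \<omega>
        \<le> ennreal (X T \<omega> * Z T \<omega>)"
      using nonneg[of \<omega>] by (auto simp: indicator_def mult_left_mono intro!: ennreal_leI
          mult_right_mono[of 1 "X T \<omega>" "Z T \<omega>", simplified])
  qed
  also have "\<dots> = ennreal (\<integral>\<omega>. X T \<omega> * Z T \<omega> \<partial>P)"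
    using int nonneg by (intro nn_integral_eq_integral) auto
  finally show ?thesis
    using exp by (meson ennreal_leI order_trans)
qed

end

section \<open>Sequences of markets\<close>

lemma NAA_imp_tight:
  assumes market: "\<And>n. n \<ge> 1 \<Longrightarrow> market (P n) (T n) (I n) (F n) (\<X> n)"
    and NAA: "NAA P T \<X>" and Y: "\<And>n. n \<ge> 1 \<Longrightarrow> Y n \<in> unit_start (P n) (\<X> n)"
  shows "tight_variables P (\<lambda>n. Y n (T n))"
proof (rule tight_variables_if_escaping_levels)
  fix n :: nat assume "n \<ge> 1"
  then interpret market "P n" "T n" "I n" "F n" "\<X> n" by (rule market)
  show "prob_space (P n)" by unfold_locales
  show "Y n (T n) \<in> borel_measurable (P n)"
    using Y[OF \<open>n \<ge> 1\<close>] by (auto simp: unit_start_def intro: wealth_measurable)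
next
  fix K :: "nat \<Rightarrow> real"
  assume pos: "\<And>n. 0 < K n" and lim: "filterlim K at_top sequentially"
  define X where "X n t \<omega> = inverse (K n) * Y n t \<omega>" for n t \<omega>
  have "X n \<in> \<X> n \<and> starts_at (P n) (X n) (inverse (K n))" if n: "n \<ge> 1" for n
  proof
    interpret market "P n" "T n" "I n" "F n" "\<X> n" using n by (rule market)
    have Yn: "Y n \<in> \<X> n" "starts_at (P n) (Y n) 1"
      using Y[OF n] by (auto simp: unit_start_def)
    show "X n \<in> \<X> n"
      using scale_mem[OF Yn(1), of "inverse (K n)"] pos[of n] unfolding X_def by simp
    show "starts_at (P n) (X n) (inverse (K n))"
      using Yn(2) unfolding starts_at_def X_def by eventually_elim simp
  qed
  moreover have "(\<lambda>n. inverse (K n)) \<longlonglongrightarrow> 0"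
    using lim by (rule tendsto_inverse_0_at_top)
  ultimately have "limsup (\<lambda>n. ereal (measure (P n) {\<omega> \<in> space (P n). 1 \<le> X n (T n) \<omega>})) = 0"
    by (intro NAA[unfolded NAA_def, THEN spec[of _ X], THEN spec[of _ "\<lambda>n. inverse (K n)"],
          THEN mp, THEN mp]) auto
  moreover have "1 \<le> X n (T n) \<omega> \<longleftrightarrow> K n \<le> Y n (T n) \<omega>" for n \<omega>
    using pos[of n] by (simp add: X_def field_simps)
  ultimately show "(\<lambda>n. measure (P n) {\<omega> \<in> space (P n). K n \<le> Y n (T n) \<omega>}) \<longlonglongrightarrow> 0"
    by (simp add: limsup_nonneg_eq_0_iff)
qed

text \<open>
  Given \<open>\<epsilon>\<close>, tightness provides a level \<open>K\<close> that makes the first term of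
  \<open>prob_le_tail_plus_inverse_density\<close> small; as \<open>K\<close> does not depend on \<open>n\<close>, the second term
  vanishes with the measure of density \<open>1/V\<close>.
\<close>
lemma tight_imp_contiguous_inverse:
  assumes basis: "\<And>n. n \<ge> 1 \<Longrightarrow> stochastic_basis (P n) (T n) (I n) (F n)"
    and tight: "tight_variables P v"
    and meas: "\<And>n. n \<ge> 1 \<Longrightarrow> v n \<in> borel_measurable (P n)"
    and pos: "\<And>n \<omega>. n \<ge> 1 \<Longrightarrow> \<omega> \<in> space (P n) \<Longrightarrow> 0 < v n \<omega>"
  shows "contiguous P (\<lambda>n. density (P n) (\<lambda>\<omega>. ennreal (inverse (v n \<omega>))))"
  unfolding contiguous_def
proof (intro allI impI)
  fix A
  let ?Q = "\<lambda>n. emeasure (density (P n) (\<lambda>\<omega>. ennreal (inverse (v n \<omega>)))) (A n)"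
  assume A: "\<forall>n\<ge>1. A n \<in> sets (P n)" and Q: "?Q \<longlonglongrightarrow> 0"
  show "(\<lambda>n. emeasure (P n) (A n)) \<longlonglongrightarrow> 0"
  proof (rule order_tendstoI)
    fix b :: ennreal assume "0 < b"
    then obtain y where y: "0 < y" "y < b"
      using dense by blast
    then have "y < top"
      using top_greatest less_le_trans by blast
    with y obtain \<epsilon> :: real where e: "0 < \<epsilon>" "ennreal \<epsilon> < b"
      by (cases y) auto
    from tight_variablesD[OF tight, of "\<epsilon> / 2"] e(1) obtain K where K: "0 < K"
      "\<forall>\<^sub>F n in sequentially. measure (P n) {\<omega> \<in> space (P n). K \<le> v n \<omega>} < \<epsilon> / 2"
      by auto
    have "(\<lambda>n. ennreal K * ?Q n) \<longlonglongrightarrow> ennreal K * 0"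
      using Q by (intro ennreal_tendsto_cmult) auto
    then have "\<forall>\<^sub>F n in sequentially. ennreal K * ?Q n < ennreal (\<epsilon> / 2)"
      using e(1) by (intro order_tendstoD(2)[where y = 0]) auto
    then show "\<forall>\<^sub>F n in sequentially. emeasure (P n) (A n) < b"
      using K(2) eventually_ge_at_top[of 1]
    proof eventually_elim
      case (elim n)
      interpret stochastic_basis "P n" "T n" "I n" "F n"
        using elim(3) by (rule basis)
      have "emeasure (P n) (A n) \<le> ennreal (measure (P n) {\<omega> \<in> space (P n). K \<le> v n \<omega>})
          + ennreal K * ?Q n"
        using A elim(3) meas pos K(1) by (intro prob_le_tail_plus_inverse_density) auto
      also have "\<dots> \<le> ennreal (\<epsilon> / 2) + ennreal (\<epsilon> / 2)"
        using elim(1,2) by (intro add_mono ennreal_leI) auto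
      also have "\<dots> = ennreal \<epsilon>"
        using e(1) by (simp add: ennreal_plus[symmetric] del: ennreal_plus)
      finally show ?case
        using e(2) by (rule le_less_trans)
    qed
  qed simp
qed

lemma contiguous_density_imp_NAA:
  assumes market: "\<And>n. n \<ge> 1 \<Longrightarrow> market (P n) (T n) (I n) (F n) (\<X> n)"
    and Z: "\<And>n. n \<ge> 1 \<Longrightarrow> Z n \<in> supermartingale_densities (P n) (I n) (F n) (\<X> n)"
    and cont: "contiguous P (\<lambda>n. density (P n) (\<lambda>\<omega>. ennreal (Z n (T n) \<omega>)))"
  shows "NAA P T \<X>"
  unfolding NAA_def
proof (intro allI impI)
  fix X x
  assume X: "\<forall>n\<ge>1. X n \<in> \<X> n \<and> starts_at (P n) (X n) (x n)" and x: "x \<longlonglongrightarrow> 0"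
  define A where "A n = {\<omega> \<in> space (P n). 1 \<le> X n (T n) \<omega>}" for n
  have A: "A n \<in> sets (P n)" if n: "n \<ge> 1" for n
  proof -
    interpret market "P n" "T n" "I n" "F n" "\<X> n" using n by (rule market)
    have [measurable]: "X n (T n) \<in> borel_measurable (P n)"
      using X n wealth_measurable by blast
    show ?thesis unfolding A_def by measurable
  qed
  have "(\<lambda>n. emeasure (density (P n) (\<lambda>\<omega>. ennreal (Z n (T n) \<omega>))) (A n)) \<longlonglongrightarrow> 0"
  proof (rule tendsto_sandwich[of "\<lambda>_. 0" _ _ "\<lambda>n. ennreal (x n)"])
    show "\<forall>\<^sub>F n in sequentially.
        emeasure (density (P n) (\<lambda>\<omega>. ennreal (Z n (T n) \<omega>))) (A n) \<le> ennreal (x n)"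
      using eventually_ge_at_top[of 1]
    proof eventually_elim
      case (elim n)
      interpret market "P n" "T n" "I n" "F n" "\<X> n" using elim by (rule market)
      show ?case
        unfolding A_def using X elim Z by (intro density_measure_reaching_one) auto
    qed
    show "(\<lambda>n. ennreal (x n)) \<longlonglongrightarrow> 0"
      using tendsto_ennrealI[OF x] by simp
  qed auto
  then have "(\<lambda>n. emeasure (P n) (A n)) \<longlonglongrightarrow> 0"
    using cont A unfolding contiguous_def by blast
  then have "(\<lambda>n. measure (P n) (A n)) \<longlonglongrightarrow> 0"
    unfolding measure_def using tendsto_enn2real[where l = 0] by simp
  then show "limsup (\<lambda>n. ereal (measure (P n) {\<omega> \<in> space (P n). 1 \<le> X n (T n) \<omega>})) = 0"
    unfolding A_def by (simp add: limsup_nonneg_eq_0_iff)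
qed

theorem theorem2p1:
  fixes P :: "nat \<Rightarrow> 'a measure"
    and T :: "nat \<Rightarrow> real"
    and I :: "nat \<Rightarrow> real set"
    and F :: "nat \<Rightarrow> real \<Rightarrow> 'a measure"
    and \<X> :: "nat \<Rightarrow> 'a process set"
    and V :: "nat \<Rightarrow> 'a process"
  assumes "\<And>n. n \<ge> 1 \<Longrightarrow> market (P n) (T n) (I n) (F n) (\<X> n)"
    and "\<And>n. n \<ge> 1 \<Longrightarrow> numeraire_portfolio (P n) (I n) (F n) (\<X> n) (V n)"
  defines "a \<equiv> NAA P T \<X>"
    and "b \<equiv> (\<forall>Y. (\<forall>n\<ge>1. Y n \<in> unit_start (P n) (\<X> n)) \<longrightarrow>
                  tight_variables P (\<lambda>n. Y n (T n)))"
    and "c \<equiv> tight_variables P (\<lambda>n. V n (T n))"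
    and "d \<equiv> contiguous P (\<lambda>n. density (P n) (\<lambda>\<omega>. ennreal (inverse (V n (T n) \<omega>))))"
    and "e \<equiv> (\<exists>Z. (\<forall>n\<ge>1. Z n \<in> supermartingale_densities (P n) (I n) (F n) (\<X> n)) \<and>
                  contiguous P (\<lambda>n. density (P n) (\<lambda>\<omega>. ennreal (Z n (T n) \<omega>))))"
  shows "(a \<longleftrightarrow> b) \<and> (b \<longleftrightarrow> c) \<and> (c \<longleftrightarrow> d) \<and> (d \<longleftrightarrow> e)"
proof -
  have V: "V n \<in> unit_start (P n) (\<X> n)" "V n (T n) \<in> borel_measurable (P n)"
    "\<And>\<omega>. \<omega> \<in> space (P n) \<Longrightarrow> 0 < V n (T n) \<omega>"
    "(\<lambda>t \<omega>. inverse (V n t \<omega>)) \<in> supermartingale_densities (P n) (I n) (F n) (\<X> n)"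
    if n: "n \<ge> 1" for n
  proof -
    interpret market "P n" "T n" "I n" "F n" "\<X> n" using n by (rule assms(1))
    show "V n \<in> unit_start (P n) (\<X> n)"
      and "\<And>\<omega>. \<omega> \<in> space (P n) \<Longrightarrow> 0 < V n (T n) \<omega>"
      using assms(2)[OF n] horizon_in_time
      unfolding numeraire_portfolio_def pos_process_def by auto
    then show "V n (T n) \<in> borel_measurable (P n)"
      by (auto simp: unit_start_def intro: wealth_measurable)
    show "(\<lambda>t \<omega>. inverse (V n t \<omega>)) \<in> supermartingale_densities (P n) (I n) (F n) (\<X> n)"
      using assms(2)[OF n] by (rule inverse_numeraire_is_density)
  qed
  have "a \<Longrightarrow> b"
    unfolding a_def b_def using NAA_imp_tight[of P T I F \<X>, OF assms(1)] by blast
  moreover have "b \<Longrightarrow> c"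
    unfolding b_def c_def using V(1) by blast
  moreover have "c \<Longrightarrow> d"
    unfolding c_def d_def
    using assms(1) V(2,3) by (intro tight_imp_contiguous_inverse[of P T I F]) (auto simp: market_def)
  moreover have "d \<Longrightarrow> e"
    unfolding d_def e_def using V(4) by (intro exI[of _ "\<lambda>n t \<omega>. inverse (V n t \<omega>)"]) auto
  moreover have "e \<Longrightarrow> a"
    unfolding e_def a_def using contiguous_density_imp_NAA[of P T I F \<X>, OF assms(1)] by blast
  ultimately show ?thesis
    by blast
qed

end
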